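(* Let $X$ and $Y$ be Banach spaces over $\mathbb{K}$ ($\mathbb{K}=\mathbb{R}$ or $\mathbb{C}$), and let $T\colon X\to Y^*$ be a weakly compact bounded linear operator. Then the following are equivalent. (a) $T\in w^*\mathrm{QNA}(X,Y^* )$. (b) $T\in\mathrm{QNA}(X,Y^* )$.
   Context: Banach spaces are over $\mathbb{K}=\mathbb{R}$ or $\mathbb{C}$. $B_X$ is the closed unit ball of $X$ and $X^*$ its topological dual. For a bounded linear operator $T\colon X\to Y^*$: $T\in\mathrm{QNA}(X,Y^* )$ ($T$ quasi attains its norm) if the norm closure of $T(B_X)$ intersects the sphere $\{u^*\in Y^*:\|u^*\|=\|T\|\}$; $T\in w^*\mathrm{QNA}(X,Y^* )$ ($T$ weak-star quasi attains its norm) if the $\sigma(Y^*,Y)$-closure of $T(B_X)$ intersects the sphere $\{u^*\in Y^*:\|u^*\|=\|T\|\}$. *)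

theory Defs
  imports "HOL-Analysis.Analysis"
begin

(* Scalars are a type 'k::real_normed_field, used below for real and complex only.
   A Banach space over 'k is a real Banach space (class banach) together with a scalar
   multiplication by 'k that extends scaleR and for which the norm is homogeneous. *)
definition normed_space_over ::
    "('k::real_normed_field \<Rightarrow> 'a::real_normed_vector \<Rightarrow> 'a) \<Rightarrow> bool" where
  "normed_space_over sc \<longleftrightarrow>
     vector_space sc \<and>
     (\<forall>r x. sc (of_real r) x = r *\<^sub>R x) \<and>
     (\<forall>c x. norm (sc c x) = norm c * norm x)"

(* The dual over 'k: elements of the blinfun type are only real-linear, so homogeneity over 'k is
   required in addition. The norm of the dual is the blinfun (operator) norm. *)
definition dual ::
    "('k \<Rightarrow> 'b \<Rightarrow> 'b) \<Rightarrow> ('b::real_normed_vector \<Rightarrow>\<^sub>L 'k::real_normed_field) set" where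
  "dual sc = {u. \<forall>c y. blinfun_apply u (sc c y) = c * blinfun_apply u y}"

definition dual_scale ::
    "'k \<Rightarrow> ('b::real_normed_vector \<Rightarrow>\<^sub>L 'k::real_normed_field) \<Rightarrow> ('b \<Rightarrow>\<^sub>L 'k)" where
  "dual_scale c u = blinfun_mult_right c o\<^sub>L u"

lemma blinfun_apply_dual_scale [simp]:
  "blinfun_apply (dual_scale c u) y = c * blinfun_apply u y"
  by (simp add: dual_scale_def)

(* Bounded 'k-linear operators from X to Y*; additivity and boundedness come from the type. *)
definition operator_into_dual ::
    "('k \<Rightarrow> 'a \<Rightarrow> 'a) \<Rightarrow> ('k \<Rightarrow> 'b \<Rightarrow> 'b) \<Rightarrow>
     ('a::real_normed_vector \<Rightarrow>\<^sub>L ('b::real_normed_vector \<Rightarrow>\<^sub>L 'k::real_normed_field)) \<Rightarrow> bool" where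
  "operator_into_dual scX scY T \<longleftrightarrow>
     (\<forall>x. blinfun_apply T x \<in> dual scY) \<and>
     (\<forall>c x. blinfun_apply T (scX c x) = dual_scale c (blinfun_apply T x))"

(* Over the reals these conditions hold automatically. *)
lemma dual_scaleR: "dual scaleR = UNIV"
  by (auto simp: dual_def blinfun.scaleR_right)

lemma operator_into_dual_scaleR: "operator_into_dual scaleR scaleR T"
  by (auto simp: operator_into_dual_def dual_scaleR blinfun.scaleR_right
      intro!: blinfun_eqI simp: blinfun.scaleR_left)

(* Y**, the topological dual of the normed space Y*. Since Y* is a subset of its type, elements of
   Y** are functions that matter only on that subset; their values elsewhere are arbitrary. *)
definition bidual ::
    "('k \<Rightarrow> 'b \<Rightarrow> 'b) \<Rightarrow>
     (('b::real_normed_vector \<Rightarrow>\<^sub>L 'k::real_normed_field) \<Rightarrow> 'k) set" where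
  "bidual sc = {\<phi>.
     (\<forall>u\<in>dual sc. \<forall>v\<in>dual sc. \<phi> (u + v) = \<phi> u + \<phi> v) \<and>
     (\<forall>c. \<forall>u\<in>dual sc. \<phi> (dual_scale c u) = c * \<phi> u) \<and>
     continuous_on (dual sc) \<phi>}"

(* The topology \<sigma>(D, F): the coarsest one on D making all members of F continuous. *)
definition sigma_topology ::
    "'d set \<Rightarrow> ('d \<Rightarrow> 'k::topological_space) set \<Rightarrow> 'd topology" where
  "sigma_topology D F =
     topology_generated_by {{u \<in> D. \<phi> u \<in> U} | \<phi> U. \<phi> \<in> F \<and> open U}"

lemma topspace_sigma_topology: "F \<noteq> {} \<Longrightarrow> topspace (sigma_topology D F) = D"
  by (auto simp: sigma_topology_def topology_generated_by_topspace)

definition weak_topology ::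
    "('k \<Rightarrow> 'b \<Rightarrow> 'b) \<Rightarrow> ('b::real_normed_vector \<Rightarrow>\<^sub>L 'k::real_normed_field) topology" where
  "weak_topology sc = sigma_topology (dual sc) (bidual sc)"

definition weak_star_topology ::
    "('k \<Rightarrow> 'b \<Rightarrow> 'b) \<Rightarrow> ('b::real_normed_vector \<Rightarrow>\<^sub>L 'k::real_normed_field) topology" where
  "weak_star_topology sc = sigma_topology (dual sc) (range (\<lambda>y u. blinfun_apply u y))"

definition weakly_compact_operator ::
    "('k \<Rightarrow> 'b \<Rightarrow> 'b) \<Rightarrow>
     ('a::real_normed_vector \<Rightarrow>\<^sub>L ('b::real_normed_vector \<Rightarrow>\<^sub>L 'k::real_normed_field)) \<Rightarrow> bool" where
  "weakly_compact_operator scY T \<longleftrightarrow>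
     compactin (weak_topology scY) (weak_topology scY closure_of (blinfun_apply T ` cball 0 1))"

definition QNA ::
    "('k \<Rightarrow> 'b \<Rightarrow> 'b) \<Rightarrow>
     ('a::real_normed_vector \<Rightarrow>\<^sub>L ('b::real_normed_vector \<Rightarrow>\<^sub>L 'k::real_normed_field)) \<Rightarrow> bool" where
  "QNA scY T \<longleftrightarrow>
     closure (blinfun_apply T ` cball 0 1) \<inter> {u \<in> dual scY. norm u = norm T} \<noteq> {}"

definition weak_star_QNA ::
    "('k \<Rightarrow> 'b \<Rightarrow> 'b) \<Rightarrow>
     ('a::real_normed_vector \<Rightarrow>\<^sub>L ('b::real_normed_vector \<Rightarrow>\<^sub>L 'k::real_normed_field)) \<Rightarrow> bool" where
  "weak_star_QNA scY T \<longleftrightarrow>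
     (weak_star_topology scY closure_of (blinfun_apply T ` cball 0 1))
       \<inter> {u \<in> dual scY. norm u = norm T} \<noteq> {}"

end

theory Submission
  imports Defs
begin

text \<open>
  The weak closure K of the image C of the unit ball is weakly compact, hence compact and therefore
  closed in the coarser, Hausdorff weak-star topology. So the weak-star closure of C lies in K, and
  by Mazur's theorem K is the norm closure of C because C is convex. The Hahn--Banach theorem
  behind Mazur's theorem is obtained from Zorn's lemma applied to total functions: a minimal
  sublinear functional is linear.
\<close>

section \<open>Sublinear functionals and their flattening along a direction\<close>

definition sublinear :: "('a::real_vector \<Rightarrow> real) \<Rightarrow> bool" where
  "sublinear q \<longleftrightarrow>
     (\<forall>x y. q (x + y) \<le> q x + q y) \<and> (\<forall>t x. 0 \<le> t \<longrightarrow> q (t *\<^sub>R x) = t * q x)"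

text \<open>One inequality for positive scalars suffices: applied to the scalar
  \<open>inverse t\<close> and the vector \<open>t *\<^sub>R x\<close> it gives the reverse
  one.\<close>

lemma sublinearI:
  assumes add: "\<And>x y. q (x + y) \<le> q x + q y"
    and zero: "q 0 = 0"
    and scale: "\<And>t x. 0 < t \<Longrightarrow> q (t *\<^sub>R x) \<le> t * q x"
  shows "sublinear q"
proof -
  have "q (t *\<^sub>R x) = t * q x" if "0 \<le> t" for t x
  proof (cases "t = 0")
    case False
    with that have t: "0 < t" by simp
    have "q (inverse t *\<^sub>R (t *\<^sub>R x)) \<le> inverse t * q (t *\<^sub>R x)"
      using t by (intro scale) simp
    then have "t * q x \<le> q (t *\<^sub>R x)"
      using t by (simp add: field_simps)
    with scale[OF t, of x] show ?thesis by simp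
  qed (simp add: zero)
  with add show ?thesis by (simp add: sublinear_def)
qed

lemma sublinear_add: "sublinear q \<Longrightarrow> q (x + y) \<le> q x + q y"
  and sublinear_scale: "sublinear q \<Longrightarrow> 0 \<le> t \<Longrightarrow> q (t *\<^sub>R x) = t * q x"
  by (simp_all add: sublinear_def)

lemma sublinear_zero: "sublinear q \<Longrightarrow> q 0 = 0"
  using sublinear_scale[of q 0 0] by simp

lemma sublinear_minus: "sublinear q \<Longrightarrow> - q (- x) \<le> q x"
  using sublinear_add[of q x "- x"] sublinear_zero[of q] by simp

text \<open>For minimal \<open>q\<close>, comparing \<open>flatten q a = q\<close> with the term \<open>t = 1\<close> gives
  \<open>q x + q a \<le> q (x + a)\<close>.\<close>

definition flatten :: "('a::real_vector \<Rightarrow> real) \<Rightarrow> 'a \<Rightarrow> 'a \<Rightarrow> real" where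
  "flatten q a x = (INF t\<in>{0..}. q (x + t *\<^sub>R a) - t * q a)"

lemma flatten_le:
  assumes "sublinear q" "0 \<le> t"
  shows "flatten q a x \<le> q (x + t *\<^sub>R a) - t * q a"
proof -
  \<comment> \<open>Subadditivity on \<open>s *\<^sub>R a = (x + s *\<^sub>R a) + (- x)\<close>
    gives a lower bound independent of \<open>s\<close>, as an infimum of reals requires.\<close>
  have "- q (- x) \<le> q (x + s *\<^sub>R a) - s * q a" if "0 \<le> s" for s
    using sublinear_add[OF assms(1), of "x + s *\<^sub>R a" "- x"] sublinear_scale[OF assms(1) that, of a]
    by simp
  then have "bdd_below ((\<lambda>s. q (x + s *\<^sub>R a) - s * q a) ` {0..})"
    by (intro bdd_belowI2[of _ "- q (- x)"]) simp
  then show ?thesis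
    unfolding flatten_def using assms(2) by (intro cINF_lower) auto
qed

lemma flatten_greatest:
  "(\<And>t. 0 \<le> t \<Longrightarrow> m \<le> q (x + t *\<^sub>R a) - t * q a) \<Longrightarrow> m \<le> flatten q a x"
  unfolding flatten_def by (rule cINF_greatest) auto

text \<open>Parameters add and scale along with the vectors: \<open>s\<close> at \<open>x\<close>
  and \<open>t\<close> at \<open>y\<close> yield \<open>s + t\<close> at \<open>x + y\<close>, and
  \<open>s\<close> at \<open>x\<close> yields \<open>t * s\<close> at
  \<open>t *\<^sub>R x\<close>.\<close>

lemma sublinear_flatten:
  assumes q: "sublinear q"
  shows "sublinear (flatten q a)"
proof (rule sublinearI)
  fix x y
  have *: "flatten q a (x + y) \<le> (q (x + s *\<^sub>R a) - s * q a) + (q (y + t *\<^sub>R a) - t * q a)"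
    if "0 \<le> s" "0 \<le> t" for s t
    using flatten_le[OF q, of "s + t" a "x + y"] that
      sublinear_add[OF q, of "x + s *\<^sub>R a" "y + t *\<^sub>R a"]
    by (simp add: algebra_simps)
  \<comment> \<open>One infimum at a time: first over \<open>t\<close> with \<open>s\<close> fixed,
    then over \<open>s\<close>.\<close>
  have "flatten q a (x + y) - (q (x + s *\<^sub>R a) - s * q a) \<le> flatten q a y" if "0 \<le> s" for s
  proof (rule flatten_greatest)
    fix t :: real assume "0 \<le> t"
    show "flatten q a (x + y) - (q (x + s *\<^sub>R a) - s * q a) \<le> q (y + t *\<^sub>R a) - t * q a"
      using *[OF that \<open>0 \<le> t\<close>] by linarith
  qed
  then have "flatten q a (x + y) - flatten q a y \<le> flatten q a x"
    by (intro flatten_greatest) (smt (verit))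
  then show "flatten q a (x + y) \<le> flatten q a x + flatten q a y" by simp
next
  show "flatten q a 0 = 0"
  proof (rule antisym)
    show "flatten q a 0 \<le> 0"
      using flatten_le[OF q, of 0 a 0] sublinear_zero[OF q] by simp
    show "0 \<le> flatten q a 0"
      by (rule flatten_greatest) (simp add: sublinear_scale[OF q])
  qed
next
  fix t :: real and x assume t: "0 < t"
  have "flatten q a (t *\<^sub>R x) / t \<le> flatten q a x"
  proof (rule flatten_greatest)
    fix s :: real assume s: "0 \<le> s"
    have "flatten q a (t *\<^sub>R x) \<le> q (t *\<^sub>R (x + s *\<^sub>R a)) - t * s * q a"
      using flatten_le[OF q, of "t * s" a "t *\<^sub>R x"] s t by (simp add: scaleR_add_right)
    also have "\<dots> = t * (q (x + s *\<^sub>R a) - s * q a)"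
      using t by (simp add: sublinear_scale[OF q] right_diff_distrib del: scaleR_add_right)
    finally show "flatten q a (t *\<^sub>R x) / t \<le> q (x + s *\<^sub>R a) - s * q a"
      using t by (simp add: field_simps)
  qed
  then show "flatten q a (t *\<^sub>R x) \<le> t * flatten q a x"
    using t by (simp add: field_simps)
qed

text \<open>\<open>flatten q a\<close> is a sublinear minorant of \<open>q\<close>, so minimality
  forces equality for every \<open>a\<close>. This makes \<open>q\<close> additive, hence odd, which
  extends homogeneity to negative scalars.\<close>

lemma minimal_sublinear_linear:
  assumes q: "sublinear q"
    and minimal: "\<And>r. sublinear r \<Longrightarrow> r \<le> q \<Longrightarrow> r = q"
  shows "linear q"
proof -
  have flat: "flatten q a = q" for a
  proof (rule minimal[OF sublinear_flatten[OF q]])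
    show "flatten q a \<le> q"
      using flatten_le[OF q, of 0 a] by (simp add: le_fun_def)
  qed
  have add: "q (x + y) = q x + q y" for x y
    using flatten_le[OF q, of 1 y x] sublinear_add[OF q, of x y] by (simp add: flat)
  have minus: "q (- x) = - q x" for x
    using add[of x "- x"] sublinear_zero[OF q] by simp
  have "q (t *\<^sub>R x) = t * q x" for t x
  proof (cases "0 \<le> t")
    case False
    then have "q ((- t) *\<^sub>R x) = (- t) * q x" by (intro sublinear_scale[OF q]) simp
    then show ?thesis by (simp add: minus)
  qed (rule sublinear_scale[OF q])
  with add show ?thesis by (intro linearI) auto
qed

section \<open>Zorn's lemma and the Hahn-Banach theorem\<close>

lemma sublinear_chain_Inf:
  assumes ne: "C \<noteq> {}" and sub: "\<And>q. q \<in> C \<Longrightarrow> sublinear q"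
    and chain: "\<And>q r. q \<in> C \<Longrightarrow> r \<in> C \<Longrightarrow> q \<le> r \<or> r \<le> q"
    and below: "\<And>q. q \<in> C \<Longrightarrow> q \<le> p"
  shows "\<exists>r. sublinear r \<and> (\<forall>q\<in>C. r \<le> q)"
proof -
  define r where "r x = (INF q\<in>C. q x)" for x
  \<comment> \<open>From \<open>q \<le> p\<close> follows
    \<open>- p (- x) \<le> - q (- x) \<le> q x\<close>, so the pointwise infimum is finite.\<close>
  have lower: "- p (- x) \<le> q x" if "q \<in> C" for q x
    using sublinear_minus[OF sub[OF that], of x] below[OF that] by (smt (verit) le_fun_def)
  have le: "r x \<le> q x" if "q \<in> C" for q x
    unfolding r_def using lower that by (intro cINF_lower bdd_belowI2[of _ "- p (- x)"])
  have greatest: "m \<le> r x" if "\<And>q. q \<in> C \<Longrightarrow> m \<le> q x" for m x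
    unfolding r_def using ne that by (rule cINF_greatest)
  have "sublinear r"
  proof (rule sublinearI)
    fix x y
    \<comment> \<open>The chain property enters here: the smaller of the two members can serve at
      both points, and its own subadditivity applies.\<close>
    have *: "r (x + y) \<le> q x + q' y" if "q \<in> C" "q' \<in> C" for q q'
    proof (cases "q \<le> q'")
      case True
      have "q y \<le> q' y" using True by (simp add: le_fun_def)
      with le[OF that(1), of "x + y"] sublinear_add[OF sub[OF that(1)], of x y]
      show ?thesis by linarith
    next
      case False
      with chain[OF that] have "q' x \<le> q x" by (auto simp: le_fun_def)
      with le[OF that(2), of "x + y"] sublinear_add[OF sub[OF that(2)], of x y]
      show ?thesis by linarith
    qed
    have "r (x + y) - q x \<le> r y" if "q \<in> C" for q
    proof (rule greatest)
      fix q' assume "q' \<in> C"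
      show "r (x + y) - q x \<le> q' y" using *[OF that \<open>q' \<in> C\<close>] by linarith
    qed
    then have "r (x + y) - r y \<le> r x"
      by (intro greatest) (smt (verit))
    then show "r (x + y) \<le> r x + r y" by simp
  next
    show "r 0 = 0" using ne by (simp add: r_def sublinear_zero[OF sub])
  next
    fix t :: real and x assume t: "0 < t"
    have "r (t *\<^sub>R x) / t \<le> r x"
    proof (rule greatest)
      fix q assume "q \<in> C"
      then show "r (t *\<^sub>R x) / t \<le> q x"
        using le[of q "t *\<^sub>R x"] sublinear_scale[OF sub[of q], of t x] t
        by (simp add: field_simps)
    qed
    then show "r (t *\<^sub>R x) \<le> t * r x" using t by (simp add: field_simps)
  qed
  with le show ?thesis by (auto simp: le_fun_def)
qed

lemma linear_below_sublinear:
  assumes p: "sublinear p"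
  shows "\<exists>f. linear f \<and> f \<le> p"
proof -
  define A where "A = {q. sublinear q \<and> q \<le> p}"
  \<comment> \<open>A minimal element is a maximal one for the reversed order
    \<open>(\<ge>)\<close>; chains are bounded by their infimum, the empty chain by
    \<open>p\<close>.\<close>
  have "\<exists>m\<in>A. \<forall>q\<in>A. m \<ge> q \<longrightarrow> q = m"
  proof (rule predicate_Zorn)
    show "partial_order_on A (relation_of (\<ge>) A)"
      by (auto simp: partial_order_on_def preorder_on_def refl_on_def trans_def antisym_def
          relation_of_def)
  next
    fix C assume C: "C \<in> Chains (relation_of (\<ge>) A)"
    then have sub: "C \<subseteq> A" and chain: "\<And>q r. q \<in> C \<Longrightarrow> r \<in> C \<Longrightarrow> q \<le> r \<or> r \<le> q"
      by (auto simp: Chains_def relation_of_def)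
    show "\<exists>u\<in>A. \<forall>q\<in>C. q \<ge> u"
    proof (cases "C = {}")
      case True
      with p show ?thesis by (auto simp: A_def)
    next
      case False
      then obtain r where r: "sublinear r" "\<forall>q\<in>C. r \<le> q"
        using sublinear_chain_Inf[of C p] sub chain by (auto simp: A_def)
      moreover have "r \<le> p" using False sub r(2) by (auto simp: A_def intro: order_trans)
      ultimately show ?thesis by (auto simp: A_def)
    qed
  qed
  then obtain m where m: "sublinear m" "m \<le> p"
    and minimal: "\<And>q. sublinear q \<Longrightarrow> q \<le> p \<Longrightarrow> q \<le> m \<Longrightarrow> q = m"
    by (auto simp: A_def)
  have "linear m"
    using m by (intro minimal_sublinear_linear) (auto intro: minimal order_trans)
  with m show ?thesis by blast
qed

text \<open>A linear \<open>f\<close> below \<open>flatten p a\<close> is below \<open>p\<close> by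
  the term \<open>t = 0\<close>. At \<open>- a\<close> the term \<open>t = 1\<close> gives
  \<open>f (- a) \<le> - p a\<close>, which forces equality at \<open>a\<close>.\<close>

theorem hahn_banach_sublinear:
  assumes p: "sublinear p"
  obtains f where "linear f" "\<And>x. f x \<le> p x" "f a = p a"
proof -
  obtain f where f: "linear f" "f \<le> flatten p a"
    using linear_below_sublinear[OF sublinear_flatten[OF p]] by blast
  have le: "f x \<le> p x" for x
    using le_funD[OF f(2), of x] flatten_le[OF p, of 0 a x] by simp
  have "f (- a) \<le> - p a"
    using le_funD[OF f(2), of "- a"] flatten_le[OF p, of 1 a "- a"] sublinear_zero[OF p] by simp
  with le[of a] have "f a = p a" by (simp add: linear_neg[OF f(1)])
  with f le that show ?thesis by blast
qed

section \<open>Separating a point from the image of the unit ball\<close>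

text \<open>The separating functional comes from the seminorm
  \<open>p v = (INF x. norm (v - T x) + \<delta> * norm x)\<close>: it is at most \<open>norm v\<close>, at most \<open>\<delta>\<close> on
  the image of the unit ball, and exceeds \<open>\<delta>\<close> at \<open>u\<close> for small \<open>\<delta>\<close>.\<close>

lemma separation_image_ball:
  fixes T :: "'a::real_normed_vector \<Rightarrow>\<^sub>L 'b::real_normed_vector"
  assumes u: "u \<notin> closure (blinfun_apply T ` cball 0 1)"
  obtains f \<delta> where "bounded_linear f" "\<delta> < f u" "\<And>x. x \<in> cball 0 1 \<Longrightarrow> f (T x) \<le> (\<delta>::real)"
proof -
  obtain d where d: "0 < d" "\<And>x. norm x \<le> 1 \<Longrightarrow> d \<le> norm (u - T x)"
    using u by (force simp: closure_approachable dist_norm norm_minus_commute not_less)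
  \<comment> \<open>Shortening a vector of norm between 1 and \<open>1 + \<eta>\<close> to norm 1
    moves its image by at most \<open>d / 2\<close>; the summand 1 avoids division by zero for
    \<open>T = 0\<close>. The remaining distance \<open>d / 2\<close> is
    \<open>2 * \<delta>\<close>.\<close>
  define \<eta> where "\<eta> = d / (2 * (norm T + 1))"
  define \<delta> where "\<delta> = d / 4"
  have eta: "0 < \<eta>" using d(1) by (simp add: \<eta>_def add_nonneg_pos)
  have "\<eta> * norm T \<le> \<eta> * (norm T + 1)" using eta by simp
  also have "\<dots> = d / 2"
  proof -
    have "d / (2 * n) * n = d / 2" if "n \<noteq> 0" for n using that by simp
    from this[of "norm T + 1"] norm_ge_zero[of T] show ?thesis
      unfolding \<eta>_def by linarith
  qed
  finally have etaT: "\<eta> * norm T \<le> d / 2" .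
  have delta: "0 < \<delta>" and delta2: "2 * \<delta> = d / 2" using d(1) by (simp_all add: \<delta>_def)
  define p where "p v = (INF x. norm (v - T x) + \<delta> * norm x)" for v
  have p_le: "p v \<le> norm (v - T x) + \<delta> * norm x" for v x
    unfolding p_def using delta by (intro cINF_lower bdd_belowI2[of _ 0]) auto
  have p_ge: "m \<le> p v" if "\<And>x. m \<le> norm (v - T x) + \<delta> * norm x" for m v
    unfolding p_def using that by (intro cINF_greatest) auto
  have "sublinear p"
  proof (rule sublinearI)
    fix v w
    have *: "p (v + w) \<le> (norm (v - T x) + \<delta> * norm x) + (norm (w - T y) + \<delta> * norm y)" for x y
    proof -
      have "p (v + w) \<le> norm ((v - T x) + (w - T y)) + \<delta> * norm (x + y)"
        using p_le[of "v + w" "x + y"] by (simp add: blinfun.add_right algebra_simps)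
      also have "\<dots> \<le> (norm (v - T x) + norm (w - T y)) + \<delta> * (norm x + norm y)"
        using delta by (intro add_mono mult_left_mono norm_triangle_ineq) auto
      finally show ?thesis by (simp add: algebra_simps)
    qed
    have "p (v + w) - (norm (v - T x) + \<delta> * norm x) \<le> p w" for x
      by (rule p_ge) (use *[of x] in \<open>simp add: algebra_simps\<close>)
    then have "p (v + w) - p w \<le> p v"
      by (intro p_ge) (simp add: algebra_simps)
    then show "p (v + w) \<le> p v + p w" by simp
  next
    show "p 0 = 0"
    proof (rule antisym)
      show "p 0 \<le> 0" using p_le[of 0 0] by simp
      show "0 \<le> p 0" using delta by (intro p_ge) simp
    qed
  next
    fix t :: real and v assume t: "0 < t"
    have "p (t *\<^sub>R v) / t \<le> p v"
    proof (rule p_ge)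
      fix x
      have "p (t *\<^sub>R v) \<le> norm (t *\<^sub>R (v - T x)) + \<delta> * norm (t *\<^sub>R x)"
        using p_le[of "t *\<^sub>R v" "t *\<^sub>R x"] by (simp add: blinfun.scaleR_right scaleR_diff_right)
      also have "\<dots> = t * (norm (v - T x) + \<delta> * norm x)"
        using t by (simp add: distrib_left del: scaleR_diff_right)
      finally show "p (t *\<^sub>R v) / t \<le> norm (v - T x) + \<delta> * norm x"
        using t by (simp add: field_simps)
    qed
    then show "p (t *\<^sub>R v) \<le> t * p v" using t by (simp add: field_simps)
  qed
  then obtain f where f: "linear f" "\<And>v. f v \<le> p v" "f u = p u"
    using hahn_banach_sublinear by metis
  have f_le: "f v \<le> norm v" for v
    using f(2)[of v] p_le[of v 0] by simp
  have "norm (f v) \<le> norm v * 1" for v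
    using f_le[of v] f_le[of "- v"] by (simp add: linear_neg[OF f(1)] abs_le_iff)
  then have "bounded_linear f"
    by (intro bounded_linear_intro[of f 1]) (auto simp: linear_add[OF f(1)] linear_scale[OF f(1)])
  moreover have "\<delta> < f u"
  proof -
    \<comment> \<open>A strict inequality for each \<open>x\<close> need not survive the infimum, so
      a common bound above \<open>\<delta>\<close> is proved. Long vectors reach it through the
      penalty, the others through the distance from \<open>u\<close>.\<close>
    have "min (\<delta> * (1 + \<eta>)) (2 * \<delta>) \<le> p u"
    proof (rule p_ge)
      fix x :: 'a
      consider "1 + \<eta> \<le> norm x" | "norm x \<le> 1" | "1 < norm x" "norm x < 1 + \<eta>" by linarith
      then show "min (\<delta> * (1 + \<eta>)) (2 * \<delta>) \<le> norm (u - T x) + \<delta> * norm x"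
      proof cases
        case 1
        have "\<delta> * (1 + \<eta>) \<le> \<delta> * norm x" using 1 delta by (intro mult_left_mono) auto
        then show ?thesis using norm_ge_zero[of "u - T x"] by linarith
      next
        case 2
        have "0 \<le> \<delta> * norm x" using delta by simp
        with d(2)[OF 2] d(1) show ?thesis using delta2 by linarith
      next
        case 3
        have x: "x \<noteq> 0" using 3 by auto
        \<comment> \<open>The distance bound applies to \<open>sgn x\<close>, which differs from
          \<open>x\<close> by less than \<open>\<eta>\<close> in norm.\<close>
        have "d \<le> norm (u - T (sgn x))" using x by (intro d(2)) (simp add: norm_sgn)
        also have "\<dots> \<le> norm (u - T x) + norm (T (x - sgn x))"
          using norm_triangle_ineq[of "u - T x" "T (x - sgn x)"] by (simp add: blinfun.diff_right)
        also have "norm (T (x - sgn x)) \<le> norm T * norm (x - sgn x)" by (rule norm_blinfun)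
        also have "norm (x - sgn x) = norm x - 1"
        proof -
          have "x - sgn x = (norm x - 1) *\<^sub>R sgn x"
            using x by (simp add: sgn_div_norm algebra_simps)
          then have "norm (x - sgn x) = \<bar>norm x - 1\<bar>"
            using x by (simp add: norm_sgn)
          then show ?thesis using 3 by simp
        qed
        also have "norm T * (norm x - 1) \<le> norm T * \<eta>"
          using 3 by (intro mult_left_mono) auto
        finally have "d / 2 \<le> norm (u - T x)" using etaT by (simp add: mult.commute)
        moreover have "0 \<le> \<delta> * norm x" using delta by simp
        ultimately show ?thesis using delta2 by linarith
      qed
    qed
    moreover have "\<delta> < \<delta> * (1 + \<eta>)" using delta eta by simp
    ultimately show ?thesis using delta f(3) by linarith
  qed
  moreover have "f (T x) \<le> \<delta>" if "x \<in> cball 0 1" for x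
  proof -
    \<comment> \<open>Taking \<open>x\<close> itself in the infimum cancels the first
      summand.\<close>
    have "f (T x) \<le> \<delta> * norm x" using f(2)[of "T x"] p_le[of "T x" x] by simp
    also have "\<dots> \<le> \<delta>" using that delta by (simp add: mult_left_le)
    finally show ?thesis .
  qed
  ultimately show ?thesis by (rule that)
qed

section \<open>Weak, weak-star and norm topologies on the dual\<close>

lemma openin_sigma_topology_preimage:
  "\<phi> \<in> F \<Longrightarrow> open U \<Longrightarrow> openin (sigma_topology D F) {u \<in> D. \<phi> u \<in> U}"
  unfolding sigma_topology_def by (rule topology_generated_by_Basis) blast

lemma openin_weak_star_evaluation:
  assumes "open U"
  shows "openin (weak_star_topology sc) {u \<in> dual sc. blinfun_apply u y \<in> U}"
  unfolding weak_star_topology_def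
  by (rule openin_sigma_topology_preimage[OF rangeI assms])

text \<open>Makes the weak topology finer than the weak-star one, and shows that
  \<open>bidual sc\<close> is nonempty, so that the weak topology lives on all of
  \<open>dual sc\<close>.\<close>

lemma evaluation_in_bidual: "(\<lambda>u. blinfun_apply u y) \<in> bidual sc"
  by (auto simp: bidual_def blinfun.add_left intro!: continuous_intros)

lemma topspace_weak_topology: "topspace (weak_topology sc) = dual sc"
  using evaluation_in_bidual[of 0 sc] unfolding weak_topology_def
  by (intro topspace_sigma_topology) blast

lemma topspace_weak_star_topology: "topspace (weak_star_topology sc) = dual sc"
  unfolding weak_star_topology_def by (intro topspace_sigma_topology) blast

text \<open>The universal property of an initial topology, used to compare topologies on one set:
  only subbasic sets need checking.\<close>

lemma continuous_map_sigma_topology_id: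
  assumes D: "topspace X = D" and F: "F \<noteq> {}"
    and preimage: "\<And>\<phi> U. \<phi> \<in> F \<Longrightarrow> open U \<Longrightarrow> openin X {u \<in> D. \<phi> u \<in> U}"
  shows "continuous_map X (sigma_topology D F) id"
  unfolding sigma_topology_def
proof (rule continuous_on_generated_topo)
  fix V assume "V \<in> {{u \<in> D. \<phi> u \<in> U} | \<phi> U. \<phi> \<in> F \<and> open U}"
  then obtain \<phi> U where V: "V = {u \<in> D. \<phi> u \<in> U}" "\<phi> \<in> F" "open U" by blast
  then have "id -` V \<inter> topspace X = V" using D by auto
  with preimage[OF V(2,3)] V(1) show "openin X (id -` V \<inter> topspace X)" by simp
next
  \<comment> \<open>With \<open>U = UNIV\<close> any member of \<open>F\<close> gives
    \<open>D\<close> itself as a subbasic set.\<close>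
  show "id ` topspace X \<subseteq> \<Union> {{u \<in> D. \<phi> u \<in> U} | \<phi> U. \<phi> \<in> F \<and> open U}"
    using D F by (auto intro: exI[of _ UNIV])
qed

text \<open>Distinct functionals differ at some \<open>y\<close>; disjoint neighbourhoods of the two
  values are pulled back along evaluation at \<open>y\<close>.\<close>

lemma Hausdorff_weak_star_topology: "Hausdorff_space (weak_star_topology sc)"
  unfolding Hausdorff_space_def topspace_weak_star_topology
proof (intro allI impI)
  fix u v assume uv: "u \<in> dual sc \<and> v \<in> dual sc \<and> u \<noteq> v"
  then obtain y where "blinfun_apply u y \<noteq> blinfun_apply v y"
    by (auto intro: blinfun_eqI)
  then obtain U V where UV: "open U" "open V"
    "blinfun_apply u y \<in> U" "blinfun_apply v y \<in> V" "U \<inter> V = {}"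
    using hausdorff[of "blinfun_apply u y" "blinfun_apply v y"] by metis
  define U' V' where "U' = {w \<in> dual sc. blinfun_apply w y \<in> U}"
    and "V' = {w \<in> dual sc. blinfun_apply w y \<in> V}"
  then have "openin (weak_star_topology sc) U'" "openin (weak_star_topology sc) V'"
    "u \<in> U'" "v \<in> V'" "disjnt U' V'"
    using uv UV by (auto simp: openin_weak_star_evaluation disjnt_def)
  then show "\<exists>U V. openin (weak_star_topology sc) U \<and> openin (weak_star_topology sc) V
      \<and> u \<in> U \<and> v \<in> V \<and> disjnt U V"
    by metis
qed

lemma continuous_map_weak_weak_star:
  "continuous_map (weak_topology sc) (weak_star_topology sc) id"
  unfolding weak_star_topology_def
  by (intro continuous_map_sigma_topology_id topspace_weak_topology)
    (auto simp: weak_topology_def evaluation_in_bidual intro!: openin_sigma_topology_preimage)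

text \<open>Point evaluations are norm continuous. The subspace topology appears because the
  operator type may also contain maps that are only real-linear.\<close>

lemma continuous_map_norm_weak_star:
  fixes sc :: "'k::real_normed_field \<Rightarrow> 'b::real_normed_vector \<Rightarrow> 'b"
  shows "continuous_map (top_of_set (dual sc)) (weak_star_topology sc) id"
  unfolding weak_star_topology_def
proof (intro continuous_map_sigma_topology_id)
  fix \<phi> :: "('b \<Rightarrow>\<^sub>L 'k) \<Rightarrow> 'k" and U :: "'k set"
  assume "\<phi> \<in> range (\<lambda>y u. blinfun_apply u y)" "open U"
  then obtain y where \<phi>: "\<phi> = (\<lambda>u. blinfun_apply u y)" by blast
  have "open ((\<lambda>u. blinfun_apply u y) -` U)"
    using \<open>open U\<close> by (intro open_vimage continuous_intros)
  moreover have "{u \<in> dual sc. \<phi> u \<in> U} = dual sc \<inter> (\<lambda>u. blinfun_apply u y) -` U"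
    by (auto simp: \<phi>)
  ultimately show "openin (top_of_set (dual sc)) {u \<in> dual sc. \<phi> u \<in> U}"
    by (simp add: openin_open_Int)
qed auto

section \<open>Comparison of the closures\<close>

lemma weak_star_closure_le_weak_closure:
  assumes C: "C \<subseteq> dual sc"
    and compact: "compactin (weak_topology sc) (weak_topology sc closure_of C)"
  shows "weak_star_topology sc closure_of C \<subseteq> weak_topology sc closure_of C"
proof (rule closure_of_minimal)
  show "C \<subseteq> weak_topology sc closure_of C"
    using C by (intro closure_of_subset) (simp add: topspace_weak_topology)
  \<comment> \<open>A coarser topology in general enlarges closures; compactness, preserved by the
    continuous identity, makes the weak closure weak-star closed as well.\<close>
  have "compactin (weak_star_topology sc) (id ` (weak_topology sc closure_of C))"
    using compact continuous_map_weak_weak_star by (rule image_compactin)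
  then show "closedin (weak_star_topology sc) (weak_topology sc closure_of C)"
    using compactin_imp_closedin[OF Hausdorff_weak_star_topology] by simp
qed

text \<open>Continuous maps send closures into closures. The intersection is there because
  \<open>closure\<close> is taken in the whole operator type.\<close>

lemma norm_closure_le_weak_star_closure:
  assumes "C \<subseteq> dual sc"
  shows "closure C \<inter> dual sc \<subseteq> weak_star_topology sc closure_of C"
proof -
  have "id ` (top_of_set (dual sc) closure_of C) \<subseteq> weak_star_topology sc closure_of (id ` C)"
    using continuous_map_norm_weak_star by (rule continuous_map_image_closure_subset)
  with assms show ?thesis by (simp add: closure_of_subtopology Int_absorb2 Int_commute)
qed

text \<open>In \<open>real_part\<close>, take \<open>r\<close> to be the identity over the reals and \<open>Re\<close> over the complex
  numbers.\<close>

lemma weak_closure_image_ball_le_closure: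
  fixes T :: "'a::real_normed_vector \<Rightarrow>\<^sub>L ('b::real_normed_vector \<Rightarrow>\<^sub>L 'k::real_normed_field)"
  assumes real_part: "\<And>f :: ('b \<Rightarrow>\<^sub>L 'k) \<Rightarrow> real. bounded_linear f \<Longrightarrow>
      \<exists>\<phi>\<in>bidual sc. \<exists>r. continuous_on UNIV r \<and> f = r \<circ> \<phi>"
  shows "weak_topology sc closure_of (blinfun_apply T ` cball 0 1) \<subseteq> closure (blinfun_apply T ` cball 0 1)"
proof
  fix u assume u: "u \<in> weak_topology sc closure_of (blinfun_apply T ` cball 0 1)"
  show "u \<in> closure (blinfun_apply T ` cball 0 1)"
  proof (rule ccontr)
    assume "u \<notin> closure (blinfun_apply T ` cball 0 1)"
    then obtain f \<delta> where f: "bounded_linear f" "\<delta> < f u"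
      "\<And>x. x \<in> cball 0 1 \<Longrightarrow> f (T x) \<le> (\<delta>::real)"
      using separation_image_ball by blast
    obtain \<phi> r where \<phi>: "\<phi> \<in> bidual sc" "continuous_on UNIV r" "f = r \<circ> \<phi>"
      using real_part[OF f(1)] by blast
    \<comment> \<open>As \<open>f = r \<circ> \<phi>\<close>, this is the part of
      \<open>dual sc\<close> where \<open>f\<close> exceeds \<open>\<delta>\<close>: weakly open,
      containing \<open>u\<close> and missing the image of the ball.\<close>
    define V where "V = {v \<in> dual sc. \<phi> v \<in> r -` {\<delta><..}}"
    have "open (r -` {\<delta><..})" using \<phi>(2) by (intro open_vimage) auto
    then have "openin (weak_topology sc) V"
      unfolding weak_topology_def V_def by (intro openin_sigma_topology_preimage \<phi>(1))
    moreover have "u \<in> V"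
      using u f(2) \<phi>(3) by (auto simp: in_closure_of topspace_weak_topology V_def)
    ultimately obtain v where "v \<in> blinfun_apply T ` cball 0 1" "v \<in> V"
      using u unfolding in_closure_of by metis
    then obtain x where "x \<in> cball 0 1" "\<delta> < f (T x)" by (auto simp: \<phi>(3) V_def)
    with f(3)[of x] show False by simp
  qed
qed

text \<open>The sphere lies in \<open>dual sc\<close>, on which the two closures have the same
  trace. The hypothesis \<open>real_part\<close> isolates what depends on the scalar field.\<close>

lemma weak_star_QNA_iff_QNA:
  fixes T :: "'a::real_normed_vector \<Rightarrow>\<^sub>L ('b::real_normed_vector \<Rightarrow>\<^sub>L 'k::real_normed_field)"
  assumes real_part: "\<And>f :: ('b \<Rightarrow>\<^sub>L 'k) \<Rightarrow> real. bounded_linear f \<Longrightarrow>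
      \<exists>\<phi>\<in>bidual sc. \<exists>r. continuous_on UNIV r \<and> f = r \<circ> \<phi>"
    and T: "operator_into_dual scX sc T" "weakly_compact_operator sc T"
  shows "weak_star_QNA sc T \<longleftrightarrow> QNA sc T"
proof -
  have C: "blinfun_apply T ` cball 0 1 \<subseteq> dual sc"
    using T(1) by (auto simp: operator_into_dual_def)
  have "weak_star_topology sc closure_of (blinfun_apply T ` cball 0 1)
      \<subseteq> closure (blinfun_apply T ` cball 0 1)"
    using weak_star_closure_le_weak_closure[OF C] T(2)
      weak_closure_image_ball_le_closure[OF real_part, of T]
    by (auto simp: weakly_compact_operator_def)
  with norm_closure_le_weak_star_closure[OF C] show ?thesis
    unfolding weak_star_QNA_def QNA_def by blast
qed

section \<open>Real-linear functionals over the two scalar fields\<close>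

lemma bounded_linear_in_bidual_real:
  fixes f :: "('b::real_normed_vector \<Rightarrow>\<^sub>L real) \<Rightarrow> real"
  assumes "bounded_linear f"
  shows "f \<in> bidual sc"
proof -
  have "dual_scale c u = c *\<^sub>R u" for c and u :: "'b \<Rightarrow>\<^sub>L real"
    by (rule blinfun_eqI) (simp add: blinfun.scaleR_left)
  with assms show ?thesis
    by (auto simp: bidual_def linear_simps intro: linear_continuous_on)
qed

text \<open>The classical formula f(u) - i f(iu), which turns a real-linear functional into a
  complex-linear one with real part \<open>f\<close>.\<close>

lemma complexification_in_bidual:
  fixes f :: "('b::real_normed_vector \<Rightarrow>\<^sub>L complex) \<Rightarrow> real"
  assumes f: "bounded_linear f"
  shows "(\<lambda>u. Complex (f u) (- f (dual_scale \<i> u))) \<in> bidual sc"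
proof -
  \<comment> \<open>Splitting the scalar reduces complex homogeneity to the real linearity of
    \<open>f\<close> and to \<open>scale2\<close>, the relation that multiplication by \<i> squares
    to -1.\<close>
  have scale: "dual_scale c u = Re c *\<^sub>R u + Im c *\<^sub>R dual_scale \<i> u"
    for c and u :: "'b \<Rightarrow>\<^sub>L complex"
    by (rule blinfun_eqI)
      (simp add: blinfun.scaleR_left blinfun.add_left complex_eq_iff)
  have scale2: "dual_scale \<i> (dual_scale \<i> u) = - u" for u :: "'b \<Rightarrow>\<^sub>L complex"
    by (rule blinfun_eqI) (simp add: blinfun.minus_left mult.assoc[symmetric])
  have lin: "bounded_linear (dual_scale \<i> :: ('b \<Rightarrow>\<^sub>L complex) \<Rightarrow> _)"
    unfolding dual_scale_def by (rule bounded_bilinear.bounded_linear_right[OF bounded_bilinear_blinfun_compose])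
  have "continuous_on S (\<lambda>u. Complex (f u) (- f (dual_scale \<i> u)))" for S
    unfolding Complex_eq
    by (intro continuous_intros bounded_linear.continuous_on[OF f] bounded_linear.continuous_on[OF lin])
  moreover have "Complex (f (dual_scale c u)) (- f (dual_scale \<i> (dual_scale c u)))
      = c * Complex (f u) (- f (dual_scale \<i> u))" for c u
    unfolding scale[of c u] by (simp add: complex_eq_iff linear_simps[OF f] linear_simps[OF lin] scale2)
  moreover have "Complex (f (u + v)) (- f (dual_scale \<i> (u + v)))
      = Complex (f u) (- f (dual_scale \<i> u)) + Complex (f v) (- f (dual_scale \<i> v))" for u v
    by (simp add: complex_eq_iff linear_simps[OF f] linear_simps[OF lin])
  ultimately show ?thesis unfolding bidual_def by blast
qed

theorem corollary3p2:
  shows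
    "(\<forall>T :: 'x::banach \<Rightarrow>\<^sub>L ('y::banach \<Rightarrow>\<^sub>L real).
        operator_into_dual scaleR scaleR T \<and> weakly_compact_operator scaleR T
        \<longrightarrow> (weak_star_QNA scaleR T \<longleftrightarrow> QNA scaleR T))
     \<and>
     (\<forall>(scV :: complex \<Rightarrow> 'v \<Rightarrow> 'v) (scW :: complex \<Rightarrow> 'w \<Rightarrow> 'w)
        (T :: 'v::banach \<Rightarrow>\<^sub>L ('w::banach \<Rightarrow>\<^sub>L complex)).
        normed_space_over scV \<and> normed_space_over scW
        \<and> operator_into_dual scV scW T \<and> weakly_compact_operator scW T
        \<longrightarrow> (weak_star_QNA scW T \<longleftrightarrow> QNA scW T))"
proof (intro conjI allI impI)
  fix T :: "'x \<Rightarrow>\<^sub>L ('y \<Rightarrow>\<^sub>L real)"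
  assume T: "operator_into_dual scaleR scaleR T \<and> weakly_compact_operator scaleR T"
  show "weak_star_QNA scaleR T \<longleftrightarrow> QNA scaleR T"
  proof (rule weak_star_QNA_iff_QNA)
    fix f :: "('y \<Rightarrow>\<^sub>L real) \<Rightarrow> real" assume "bounded_linear f"
    then show "\<exists>\<phi>\<in>bidual scaleR. \<exists>r. continuous_on UNIV r \<and> f = r \<circ> \<phi>"
      by (intro bexI[of _ f] exI[of _ id] bounded_linear_in_bidual_real) auto
  qed (use T in auto)
next
  fix scV :: "complex \<Rightarrow> 'v \<Rightarrow> 'v" and scW :: "complex \<Rightarrow> 'w \<Rightarrow> 'w"
    and T :: "'v \<Rightarrow>\<^sub>L ('w \<Rightarrow>\<^sub>L complex)"
  assume T: "normed_space_over scV \<and> normed_space_over scW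
    \<and> operator_into_dual scV scW T \<and> weakly_compact_operator scW T"
  show "weak_star_QNA scW T \<longleftrightarrow> QNA scW T"
  proof (rule weak_star_QNA_iff_QNA)
    fix f :: "('w \<Rightarrow>\<^sub>L complex) \<Rightarrow> real" assume "bounded_linear f"
    then show "\<exists>\<phi>\<in>bidual scW. \<exists>r. continuous_on UNIV r \<and> f = r \<circ> \<phi>"
      by (intro bexI[of _ "\<lambda>u. Complex (f u) (- f (dual_scale \<i> u))"] exI[of _ Re]
          complexification_in_bidual) (auto intro: continuous_on_Re continuous_on_id)
  qed (use T in auto)
qed

end
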